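(* Let $f_1,\dots,f_n\in\mathbb{R}[x,y]$ be square-independent, non-constant polynomials. Assume that the $y$-leading coefficient of each $f_i$ is positive. Then for every integer $s>1$, $$p_{2s}\big(\mathbb{R}[x,y,\sqrt{f_1},\dots,\sqrt{f_n}]\big)=\infty .$$
   Context: For a commutative ring $R$ with identity and a positive integer $s$, the $2s$-Pythagoras number $p_{2s}(R)$ is the smallest positive integer $g$ such that every element of $R$ which is a (finite) sum of $2s$th powers of elements of $R$ is a sum of at most $g$ $2s$th powers of elements of $R$; if no such $g$ exists, $p_{2s}(R)=\infty$. A finite sequence $f_1,\dots,f_n\in\mathbb{R}[x,y]$ is called square-independent if for every non-empty subset $S\subseteq\{1,\dots,n\}$ the product $f_S=\prod_{i\in S}f_i$ is not a square in $\mathbb{R}[x,y]$. For $f\in\mathbb{R}[x,y]$ with $d=\deg_y f$, let $\alpha x^b y^d$ be the monomial of $f$ with nonzero coefficient $\alpha$ and with $b$ largest possible among all monomials of $f$ having $y$-degree $d$. Then $\alpha$ is called the $y$-leading coefficient of $f$. The ring $\mathbb{R}[x,y,\sqrt{f_1},\dots,\sqrt{f_n}]$ is $\mathbb{R}[x,y,z_1,\dots,z_n]/(z_1^2-f_1,\dots,z_n^2-f_n)$, with $\sqrt{f_i}$ the class of $z_i$. *)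

theory Defs
  imports
    "HOL-Algebra.QuotRing"
    "HOL-Computational_Algebra.Polynomial"
    "HOL-Library.Poly_Mapping"
    "HOL-Library.Extended_Nat"
begin

text \<open>
  The ring $\mathbb{R}[x,y]$ is \<^typ>\<open>real poly poly\<close>: the outer variable is $y$ and the
  coefficients are polynomials in $x$.
\<close>

definition square_independent :: "nat \<Rightarrow> (nat \<Rightarrow> real poly poly) \<Rightarrow> bool" where
  "square_independent n f \<longleftrightarrow>
     (\<forall>S. S \<subseteq> {1..n} \<and> S \<noteq> {} \<longrightarrow> \<not> (\<exists>g. (\<Prod>i\<in>S. f i) = g ^ 2))"

definition constant_poly2 :: "real poly poly \<Rightarrow> bool" where
  "constant_poly2 p \<longleftrightarrow> (\<exists>c. p = [:[:c:]:])"

text \<open>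
  The inner leading coefficient is the coefficient of $y^d$, $d = \deg_y p$, an element of
  $\mathbb{R}[x]$; its own leading coefficient belongs to the largest power of $x$ in it.
\<close>

definition y_lead_coeff :: "real poly poly \<Rightarrow> real" where
  "y_lead_coeff p = lead_coeff (lead_coeff p)"


text \<open>
  $\mathbb{R}[x,y,z_1,\dots,z_n]$, as polynomials in $z_1,\dots,z_n$ over $\mathbb{R}[x,y]$:
  a monomial is a finitely supported exponent function \<^typ>\<open>nat \<Rightarrow>\<^sub>0 nat\<close>, and addition of
  exponents makes \<^typ>\<open>(nat \<Rightarrow>\<^sub>0 nat) \<Rightarrow>\<^sub>0 real poly poly\<close> the polynomial ring in the variables
  $z_i$, $i \in \mathbb{N}$, with convolution as multiplication.
\<close>

definition poly_ring_z :: "nat \<Rightarrow> ((nat \<Rightarrow>\<^sub>0 nat) \<Rightarrow>\<^sub>0 real poly poly) ring" where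
  "poly_ring_z n =
     \<lparr>carrier = {P. \<forall>m \<in> Poly_Mapping.keys P. Poly_Mapping.keys m \<subseteq> {1..n}},
      monoid.mult = (*), one = 1, ring.zero = 0, add = (+)\<rparr>"

definition z_const :: "real poly poly \<Rightarrow> (nat \<Rightarrow>\<^sub>0 nat) \<Rightarrow>\<^sub>0 real poly poly" where
  "z_const p = Poly_Mapping.single 0 p"

definition z_var :: "nat \<Rightarrow> (nat \<Rightarrow>\<^sub>0 nat) \<Rightarrow>\<^sub>0 real poly poly" where
  "z_var i = Poly_Mapping.single (Poly_Mapping.single i 1) 1"

definition sqrt_ext_ring ::
    "nat \<Rightarrow> (nat \<Rightarrow> real poly poly) \<Rightarrow> ((nat \<Rightarrow>\<^sub>0 nat) \<Rightarrow>\<^sub>0 real poly poly) set ring" where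
  "sqrt_ext_ring n f =
     poly_ring_z n Quot (Idl\<^bsub>poly_ring_z n\<^esub> ((\<lambda>i. z_var i ^ 2 - z_const (f i)) ` {1..n}))"

lemma poly_ring_z_ops:
  "P \<otimes>\<^bsub>poly_ring_z n\<^esub> Q = P * Q" "\<one>\<^bsub>poly_ring_z n\<^esub> = 1"
  "P \<oplus>\<^bsub>poly_ring_z n\<^esub> Q = P + Q" "\<zero>\<^bsub>poly_ring_z n\<^esub> = 0"
  by (simp_all add: poly_ring_z_def)

lemma z_const_closed: "z_const p \<in> carrier (poly_ring_z n)"
  by (simp add: z_const_def poly_ring_z_def)

lemma z_var_closed: "i \<in> {1..n} \<Longrightarrow> z_var i \<in> carrier (poly_ring_z n)"
  by (simp add: z_var_def poly_ring_z_def)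

lemma cring_poly_ring_z: "cring (poly_ring_z n)"
proof (rule cringI)
  have zero: "0 \<in> carrier (poly_ring_z n)" and one: "1 \<in> carrier (poly_ring_z n)"
    by (simp_all add: poly_ring_z_def)
  have add_cl: "P + Q \<in> carrier (poly_ring_z n)"
    if "P \<in> carrier (poly_ring_z n)" "Q \<in> carrier (poly_ring_z n)" for P Q
    using that Poly_Mapping.keys_add[of P Q] by (auto simp: poly_ring_z_def)
  have uminus: "- P \<in> carrier (poly_ring_z n)" if "P \<in> carrier (poly_ring_z n)" for P
    using that by (auto simp: poly_ring_z_def in_keys_iff)
  have mult_cl: "P * Q \<in> carrier (poly_ring_z n)"
    if "P \<in> carrier (poly_ring_z n)" "Q \<in> carrier (poly_ring_z n)" for P Q
  proof -
    have "Poly_Mapping.keys m \<subseteq> {1..n}" if m: "m \<in> Poly_Mapping.keys (P * Q)" for m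
    proof -
      obtain a b where "m = a + b" "a \<in> Poly_Mapping.keys P" "b \<in> Poly_Mapping.keys Q"
        using m keys_mult[of P Q] by blast
      moreover from this have "Poly_Mapping.keys a \<subseteq> {1..n}" "Poly_Mapping.keys b \<subseteq> {1..n}"
        using \<open>P \<in> _\<close> \<open>Q \<in> _\<close> by (auto simp: poly_ring_z_def)
      ultimately show ?thesis
        using Poly_Mapping.keys_add[of a b] by blast
    qed
    then show ?thesis
      by (simp add: poly_ring_z_def)
  qed
  show "abelian_group (poly_ring_z n)"
  proof (rule abelian_groupI)
    fix P assume "P \<in> carrier (poly_ring_z n)"
    then show "\<exists>Q\<in>carrier (poly_ring_z n). Q \<oplus>\<^bsub>poly_ring_z n\<^esub> P = \<zero>\<^bsub>poly_ring_z n\<^esub>"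
      by (intro bexI[of _ "- P"] uminus) (simp_all add: poly_ring_z_ops)
  qed (simp_all add: poly_ring_z_ops add_cl zero add.assoc add.commute)
  show "Group.comm_monoid (poly_ring_z n)"
    by (rule comm_monoidI) (simp_all add: poly_ring_z_ops mult_cl one mult.assoc mult.commute)
qed (simp add: poly_ring_z_ops distrib_right)

lemma cring_sqrt_ext_ring: "cring (sqrt_ext_ring n f)"
proof -
  interpret cring "poly_ring_z n"
    by (rule cring_poly_ring_z)
  have "z_var i ^ 2 - z_const (f i) \<in> carrier (poly_ring_z n)" if i: "i \<in> {1..n}" for i
  proof -
    have "z_var i ^ 2 - z_const (f i) = z_var i * z_var i + z_const (- f i)"
      by (simp add: power2_eq_square z_const_def single_uminus)
    also have "\<dots> \<in> carrier (poly_ring_z n)"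
      using add.m_closed[OF m_closed[OF z_var_closed[OF i] z_var_closed[OF i]]
          z_const_closed[of "- f i"]]
      by (simp add: poly_ring_z_ops)
    finally show ?thesis .
  qed
  then have "ideal (Idl\<^bsub>poly_ring_z n\<^esub> ((\<lambda>i. z_var i ^ 2 - z_const (f i)) ` {1..n})) (poly_ring_z n)"
    by (intro genideal_ideal) blast
  then show ?thesis
    unfolding sqrt_ext_ring_def by (rule ideal.quotient_is_cring) (rule cring_poly_ring_z)
qed


definition sum_of_powers :: "('a, 'm) ring_scheme \<Rightarrow> nat \<Rightarrow> nat \<Rightarrow> 'a \<Rightarrow> bool" where
  "sum_of_powers R k l a \<longleftrightarrow>
     (\<exists>b. b \<in> {..<l} \<rightarrow> carrier R \<and> a = (\<Oplus>\<^bsub>R\<^esub>j\<in>{..<l}. b j [^]\<^bsub>R\<^esub> k))"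

definition pythagoras_bound :: "('a, 'm) ring_scheme \<Rightarrow> nat \<Rightarrow> nat \<Rightarrow> bool" where
  "pythagoras_bound R k g \<longleftrightarrow>
     0 < g \<and> (\<forall>a\<in>carrier R. (\<exists>l. sum_of_powers R k l a) \<longrightarrow> (\<exists>l\<le>g. sum_of_powers R k l a))"

text \<open>
  The subscript of $p_{2s}$ is the exponent, so $p_{2s}(R)$ is
  \<open>pythagoras_number (2 * s) R\<close>.
\<close>

definition pythagoras_number :: "nat \<Rightarrow> ('a, 'm) ring_scheme \<Rightarrow> enat" where
  "pythagoras_number k R =
     (if \<exists>g. pythagoras_bound R k g then enat (LEAST g. pythagoras_bound R k g) else \<infinity>)"

end

theory Submission
  imports Defs "HOL-Real_Asymp.Real_Asymp"
begin

text \<open>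
  In coordinates $p$, $q$ on the plane, consider $F = \sum_{k<N} (1 + b_k(p) q)^{2s}$, where the
  polynomials $b_k$ satisfy $b_k(j) = 1$ for $k < j$ and $b_k(j) = 0$ for $k \ge j$, $j = 0, \dots, N$.
  On the line $p = j$ it is $j (1 + q)^{2s} + (N - j)$. If $F = \sum_{k<g} h_k^{2s}$ with polynomials
  $h_k$, then $h_k = \alpha_k + \beta_k(p) q$ with $\alpha_k$ constant, and $s > 1$ forces
  $\beta_k(j) \in \{0, \alpha_k\}$. So every $j \le N$ is the sum of a subset of
  $\alpha_0^{2s}, \dots, \alpha_{g-1}^{2s}$, whence $N < 2^g$.

  To force the $h_k$ in the extension ring to be polynomials, $p$ and $q$ are chosen so that, for fixed
  $p$ and $q \to \infty$, every $f_i$ becomes positive and grows faster than $q^2$. All sign choices of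
  the square roots then give real points, and $|h_k| \le F^{1/2s} = O(q)$ at all of them; hence so is
  every component $g_I \prod_{i \in I} \sqrt{f_i}$ of $h_k$, and $g_I$ vanishes for $I \ne \emptyset$.
\<close>

subsection \<open>Growth of univariate polynomials\<close>

text \<open>If the degree exceeded \<open>m\<close>, division by \<open>q ^ degree r\<close> would
  send the bound to 0 but \<open>r\<close> to its nonzero leading coefficient.\<close>

lemma degree_le_of_growth:
  fixes r :: "real poly"
  assumes "\<forall>\<^sub>F q in at_top. \<bar>poly r q\<bar> \<le> C * q ^ m"
  shows "degree r \<le> m"
proof (rule ccontr)
  assume deg: "\<not> degree r \<le> m"
  have "((\<lambda>q. poly (monom C m) q / poly (monom 1 (degree r)) q) \<longlongrightarrow> 0) at_infinity"
    using deg degree_monom_le[of C m]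
    by (intro poly_divide_tendsto_0_at_infinity) (simp add: degree_monom_eq)
  then have bound: "((\<lambda>q. C * q ^ m / q ^ degree r) \<longlongrightarrow> 0) at_top"
    using at_top_le_at_infinity by (auto simp: poly_monom intro: tendsto_mono)
  have "((\<lambda>q. poly r q / q ^ degree r) \<longlongrightarrow> 0) at_top"
  proof (rule tendsto_0_le[OF bound, where K = 1])
    show "\<forall>\<^sub>F q in at_top. norm (poly r q / q ^ degree r) \<le> norm (C * q ^ m / q ^ degree r) * 1"
      using assms eventually_gt_at_top[of 0]
      by eventually_elim (simp add: divide_right_mono)
  qed
  moreover have "((\<lambda>q. poly r q / q ^ degree r) \<longlongrightarrow> lead_coeff r) at_top"
    using poly_divide_tendsto_aux[of r] at_top_le_at_infinity by (rule tendsto_mono[rotated])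
  ultimately have "lead_coeff r = 0"
    by (meson tendsto_unique trivial_limit_at_top_linorder)
  with deg show False
    by simp
qed

lemma poly_eq_0_of_tendsto_0:
  fixes r :: "real poly"
  assumes "(poly r \<longlongrightarrow> 0) at_top"
  shows "r = 0"
proof -
  have "\<forall>\<^sub>F q in at_top. \<bar>poly r q\<bar> < 1"
    using order_tendstoD(2)[OF tendsto_rabs_zero[OF assms], of 1] by simp
  then have "\<forall>\<^sub>F q in at_top. \<bar>poly r q\<bar> \<le> 1 * q ^ 0"
    by eventually_elim simp
  then have "degree r = 0"
    using degree_le_of_growth[of r 1 0] by simp
  then obtain c where r: "r = [:c:]"
    by (rule degree_eq_zeroE)
  then have "poly r = (\<lambda>_. c)"
    by auto
  with assms have "((\<lambda>_. c) \<longlongrightarrow> 0) (at_top :: real filter)"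
    by simp
  then show ?thesis
    by (simp add: r tendsto_const_iff)
qed

lemma poly_eq_of_eventually_eq:
  fixes r r' :: "real poly"
  assumes "\<forall>\<^sub>F q in at_top. poly r q = poly r' q"
  shows "r = r'"
proof -
  have "\<forall>\<^sub>F q in at_top. poly (r - r') q = 0"
    using assms by eventually_elim simp
  then have "(poly (r - r') \<longlongrightarrow> 0) at_top"
    by (rule tendsto_eventually)
  then show ?thesis
    using poly_eq_0_of_tendsto_0 by fastforce
qed

text \<open>Newton interpolation: a multiple of the polynomial vanishing exactly on the old nodes
  corrects the value at the new one.\<close>

lemma interpolation_exists:
  fixes w :: "'a::field \<Rightarrow> 'a"
  assumes "finite S"
  shows "\<exists>b. \<forall>x\<in>S. poly b x = w x"
  using assms
proof induction
  case (insert a S)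
  then obtain b where b: "\<forall>x\<in>S. poly b x = w x"
    by blast
  define D where "D = (\<Prod>s\<in>S. [:- s, 1:])"
  have D: "poly D x = 0 \<longleftrightarrow> x \<in> S" for x
    using insert.hyps by (auto simp: D_def poly_prod prod_zero_iff)
  define b' where "b' = b + smult ((w a - poly b a) / poly D a) D"
  have "\<forall>x\<in>insert a S. poly b' x = w x"
    using b D insert.hyps by (auto simp: b'_def)
  then show ?case ..
qed simp


subsection \<open>Evaluation of bivariate polynomials\<close>

definition eval2 :: "real poly poly \<Rightarrow> real \<Rightarrow> real \<Rightarrow> real" where
  "eval2 f x y = poly (poly f [:y:]) x"

lemma eval2_simps [simp]:
  "eval2 0 x y = 0" "eval2 1 x y = 1"
  "eval2 (f + g) x y = eval2 f x y + eval2 g x y"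
  "eval2 (f - g) x y = eval2 f x y - eval2 g x y"
  "eval2 (- f) x y = - eval2 f x y"
  "eval2 (f * g) x y = eval2 f x y * eval2 g x y"
  "eval2 (f ^ k) x y = eval2 f x y ^ k"
  "eval2 (pCons a f) x y = poly a x + y * eval2 f x y"
  by (simp_all add: eval2_def)

lemma eval2_sum: "eval2 (sum h A) x y = (\<Sum>i\<in>A. eval2 (h i) x y)"
  by (simp add: eval2_def poly_sum)

lemma eval2_prod: "eval2 (prod h A) x y = (\<Prod>i\<in>A. eval2 (h i) x y)"
  by (simp add: eval2_def poly_prod)

lemma eval2_altdef: "eval2 f x y = (\<Sum>j\<le>degree f. poly (coeff f j) x * y ^ j)"
  unfolding eval2_def by (subst poly_altdef) (simp add: poly_sum poly_const_pow mult.commute)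

text \<open>Fixing the inner variable leaves a univariate polynomial in the outer one, to which the
  growth lemmas apply line by line.\<close>

lemma eval2_map_poly: "eval2 f x y = poly (map_poly (\<lambda>a. poly a x) f) y"
  by (induction f) (simp_all add: map_poly_pCons)

text \<open>Substitution is recorded through values only, which is all that the later arguments
  compare. Horner's scheme in both variables builds \<open>H\<close>.\<close>

lemma eval2_compose: "\<exists>H. \<forall>p q. eval2 H p q = eval2 G (eval2 X p q) (eval2 Y p q)"
proof (induction G)
  case 0
  show ?case
    by (rule exI[of _ 0]) simp
next
  case (pCons a G)
  then obtain H where H: "\<forall>p q. eval2 H p q = eval2 G (eval2 X p q) (eval2 Y p q)"
    by blast
  have "\<exists>A. \<forall>p q. eval2 A p q = poly a (eval2 X p q)"
  proof (induction a)
    case 0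
    show ?case
      by (rule exI[of _ 0]) simp
  next
    case (pCons c a)
    then obtain A where "\<forall>p q. eval2 A p q = poly a (eval2 X p q)"
      by blast
    then show ?case
      by (intro exI[of _ "[:[:c:]:] + X * A"]) simp
  qed
  then obtain A where "\<forall>p q. eval2 A p q = poly a (eval2 X p q)"
    by blast
  with H show ?case
    by (intro exI[of _ "A + Y * H"]) simp
qed


subsection \<open>Growth along the curves\<close>

text \<open>
  The substitution $x = p + q^3$, $y = q + (p + q^3)^M$ is an automorphism of the plane. For $M$
  large it makes a polynomial with positive $y$-leading coefficient grow, as $q \to \infty$ with
  $p$ fixed, like its monomial that carries the $y$-leading coefficient.
\<close>

definition curve_x :: "real \<Rightarrow> real \<Rightarrow> real" where
  "curve_x p q = p + q ^ 3"

definition curve_y :: "nat \<Rightarrow> real \<Rightarrow> real \<Rightarrow> real" where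
  "curve_y M p q = q + curve_x p q ^ M"

lemma filterlim_curve_x: "filterlim (curve_x p) at_top at_top"
  unfolding curve_x_def by real_asymp

text \<open>For large \<open>q\<close>, \<open>curve_y\<close> is at least
  \<open>curve_x ^ M\<close>, and \<open>M\<close> exceeds all x-degrees. After the division each
  term of y-degree below \<open>degree f\<close> is therefore at most a coefficient over
  \<open>curve_x ^ M\<close>, which tends to 0. The top term leaves \<open>lead_coeff f\<close> over
  its own leading power of x.\<close>

lemma eval2_curve_tendsto:
  assumes M: "\<And>j. degree (coeff f j) < M"
  shows "((\<lambda>q. eval2 f (curve_x p q) (curve_y M p q) /
             (curve_x p q ^ degree (lead_coeff f) * curve_y M p q ^ degree f))
           \<longlongrightarrow> y_lead_coeff f) at_top"
proof -
  let ?t = "curve_x p" and ?Y = "curve_y M p"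
  let ?b = "degree (lead_coeff f)" and ?d = "degree f"
  let ?term = "\<lambda>j q. poly (coeff f j) (?t q) * ?Y q ^ j / (?t q ^ ?b * ?Y q ^ ?d)"
  have to_curve: "((\<lambda>q. g (?t q)) \<longlongrightarrow> L) at_top" if "(g \<longlongrightarrow> L) at_infinity" for g :: "real \<Rightarrow> real" and L
    using tendsto_mono[OF at_top_le_at_infinity that] filterlim_curve_x
    by (rule filterlim_compose)
  have large: "\<forall>\<^sub>F q in at_top. 1 \<le> ?t q \<and> ?t q ^ M \<le> ?Y q \<and> 1 \<le> ?Y q"
    using filterlim_at_top[THEN iffD1, OF filterlim_curve_x, rule_format, of 1 p]
      eventually_ge_at_top[of 0]
  proof eventually_elim
    case (elim q)
    then have "1 \<le> ?t q ^ M"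
      by (simp add: one_le_power)
    then have "1 \<le> q + ?t q ^ M"
      using elim by linarith
    with elim show ?case
      by (simp add: curve_y_def)
  qed
  have term_lim: "(?term j \<longlongrightarrow> (if j = ?d then y_lead_coeff f else 0)) at_top" if j: "j \<in> {..?d}" for j
  proof (cases "j = ?d")
    case True
    have "((\<lambda>q. poly (lead_coeff f) (?t q) / ?t q ^ ?b) \<longlongrightarrow> y_lead_coeff f) at_top"
      unfolding y_lead_coeff_def by (rule to_curve[OF poly_divide_tendsto_aux])
    moreover have "\<forall>\<^sub>F q in at_top. poly (lead_coeff f) (?t q) / ?t q ^ ?b = ?term j q"
      using large by eventually_elim (simp add: True)
    ultimately show ?thesis
      using True by (auto intro: Lim_transform_eventually)
  next
    case False
    with j have "j < ?d"
      by simp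
    have "((\<lambda>x. poly (coeff f j) x / poly (monom 1 M) x) \<longlongrightarrow> 0) at_infinity"
      using M by (intro poly_divide_tendsto_0_at_infinity) (simp add: degree_monom_eq)
    then have bound: "((\<lambda>q. poly (coeff f j) (?t q) / ?t q ^ M) \<longlongrightarrow> 0) at_top"
      by (intro to_curve) (simp add: poly_monom)
    have "(?term j \<longlongrightarrow> 0) at_top"
    proof (rule tendsto_0_le[OF bound, where K = 1])
      show "\<forall>\<^sub>F q in at_top. norm (?term j q) \<le> norm (poly (coeff f j) (?t q) / ?t q ^ M) * 1"
        using large
      proof eventually_elim
        case (elim q)
        have "?Y q ^ ?d = ?Y q ^ (?d - j) * ?Y q ^ j"
          using \<open>j < ?d\<close> by (simp flip: power_add)
        then have "?term j q = poly (coeff f j) (?t q) / (?t q ^ ?b * ?Y q ^ (?d - j))"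
          using elim by simp
        moreover have "?t q ^ M \<le> ?t q ^ ?b * ?Y q ^ (?d - j)"
        proof -
          have "?Y q \<le> ?Y q ^ (?d - j)"
            using elim \<open>j < ?d\<close> by (intro self_le_power) auto
          moreover have "1 \<le> ?t q ^ ?b"
            using elim by (simp add: one_le_power)
          ultimately have "1 * ?Y q \<le> ?t q ^ ?b * ?Y q ^ (?d - j)"
            using elim by (intro mult_mono) auto
          with elim show ?thesis
            by simp
        qed
        moreover have "0 < ?t q ^ M"
          using elim by simp
        ultimately show ?case
          using elim by (simp add: abs_mult frac_le)
      qed
    qed
    with False show ?thesis
      by simp
  qed
  have "((\<lambda>q. \<Sum>j\<le>?d. ?term j q) \<longlongrightarrow> (\<Sum>j\<le>?d. if j = ?d then y_lead_coeff f else 0)) at_top"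
    by (rule tendsto_sum) (use term_lim in simp)
  then show ?thesis
    by (simp add: eval2_altdef sum_divide_distrib)
qed

text \<open>By nonconstancy the leading monomial involves x or y, and on the curve both are
  eventually at least \<open>p + q ^ 3\<close>. So \<open>f\<close> is eventually at least half its
  leading coefficient times \<open>p + q ^ 3\<close>; the cube is there to beat
  \<open>q ^ 2\<close>.\<close>

lemma eval2_curve_at_top:
  assumes M: "\<And>j. degree (coeff f j) < M"
    and pos: "y_lead_coeff f > 0" and nonconst: "\<not> constant_poly2 f"
  shows "filterlim (\<lambda>q. eval2 f (curve_x p q) (curve_y M p q) / q ^ 2) at_top at_top"
proof -
  let ?t = "curve_x p" and ?Y = "curve_y M p"
  let ?b = "degree (lead_coeff f)" and ?d = "degree f"
  let ?c = "y_lead_coeff f / 2"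
  have "0 < M"
    using M[of 0] by simp
  have bd: "0 < ?b + ?d"
  proof (rule ccontr)
    assume "\<not> 0 < ?b + ?d"
    then have "?b = 0" "?d = 0"
      by auto
    from \<open>?d = 0\<close> obtain a where a: "f = [:a:]"
      by (rule degree_eq_zeroE)
    with \<open>?b = 0\<close> obtain c where "a = [:c:]"
      by (auto elim: degree_eq_zeroE)
    with a nonconst show False
      by (auto simp: constant_poly2_def)
  qed
  have ratio: "\<forall>\<^sub>F q in at_top. ?c < eval2 f (?t q) (?Y q) / (?t q ^ ?b * ?Y q ^ ?d)"
    by (rule order_tendstoD(1)[OF eval2_curve_tendsto[OF M]]) (use pos in simp)
  have "\<forall>\<^sub>F q in at_top. ?c * (p + q ^ 3) / q ^ 2 \<le> eval2 f (?t q) (?Y q) / q ^ 2"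
    using ratio filterlim_at_top[THEN iffD1, OF filterlim_curve_x, rule_format, of 1 p]
      eventually_ge_at_top[of 1]
  proof eventually_elim
    case (elim q)
    have "?t q \<le> ?t q ^ M"
      using elim \<open>0 < M\<close> by (intro self_le_power) auto
    then have Y: "?t q \<le> ?Y q"
      using elim by (simp add: curve_y_def)
    have "?t q \<le> ?t q ^ (?b + ?d)"
      using elim bd by (intro self_le_power) auto
    also have "\<dots> \<le> ?t q ^ ?b * ?Y q ^ ?d"
      unfolding power_add using elim Y by (intro mult_left_mono power_mono) auto
    finally have "?c * ?t q \<le> ?c * (?t q ^ ?b * ?Y q ^ ?d)"
      using pos by simp
    also have "\<dots> \<le> eval2 f (?t q) (?Y q)"
    proof -
      have "0 < ?t q ^ ?b * ?Y q ^ ?d"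
        using elim Y by (intro mult_pos_pos zero_less_power) auto
      with elim(1) show ?thesis
        by (simp add: pos_less_divide_eq)
    qed
    finally show ?case
      by (intro divide_right_mono) (simp_all add: curve_x_def)
  qed
  moreover have "filterlim (\<lambda>q. ?c * (p + q ^ 3) / q ^ 2) at_top at_top"
    using pos by real_asymp
  ultimately show ?thesis
    by (rule filterlim_at_top_mono[rotated])
qed

subsection \<open>A length obstruction in two variables\<close>

text \<open>The bound is itself a power with exponent \<open>2 * m\<close>, so that roots can be
  extracted from it. The number of summands is absorbed into the power as \<open>N + 1\<close>, a
  base that is at least 1 even for \<open>N = 0\<close>.\<close>

lemma linear_powers_bound:
  fixes c :: "nat \<Rightarrow> real"
  assumes "0 < m"
  obtains C where "\<And>q. 0 \<le> q \<Longrightarrow> (\<Sum>k<N. (1 + c k * q) ^ (2 * m)) \<le> (C * (1 + q)) ^ (2 * m)"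
    and "0 \<le> C"
proof
  \<comment> \<open>\<open>D\<close> is at least 1 and at least the absolute value of every
    \<open>c k\<close> with \<open>k < N\<close>, so it bounds both coefficients of each linear
    form.\<close>
  define D where "D = 1 + (\<Sum>k<N. \<bar>c k\<bar>)"
  have "1 \<le> D"
    by (simp add: D_def sum_nonneg)
  show "0 \<le> (real N + 1) * D"
    using \<open>1 \<le> D\<close> by simp
  fix q :: real
  assume q: "0 \<le> q"
  have "(1 + c k * q) ^ (2 * m) \<le> (D * (1 + q)) ^ (2 * m)" if "k < N" for k
  proof -
    have "\<bar>c k\<bar> \<le> (\<Sum>k<N. \<bar>c k\<bar>)"
      using that by (intro member_le_sum) auto
    then have "\<bar>c k\<bar> * q \<le> D * q"
      using q by (intro mult_right_mono) (auto simp: D_def)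
    then have "\<bar>1 + c k * q\<bar> \<le> D * (1 + q)"
      using \<open>1 \<le> D\<close> q abs_triangle_ineq[of 1 "c k * q"] by (simp add: abs_mult algebra_simps)
    then have "\<bar>1 + c k * q\<bar> ^ (2 * m) \<le> (D * (1 + q)) ^ (2 * m)"
      by (intro power_mono) auto
    then show ?thesis
      by (simp add: power_even_abs)
  qed
  then have "(\<Sum>k<N. (1 + c k * q) ^ (2 * m)) \<le> (\<Sum>k<N. (D * (1 + q)) ^ (2 * m))"
    by (intro sum_mono) simp
  also have "\<dots> = real N * (D * (1 + q)) ^ (2 * m)"
    by simp
  also have "\<dots> \<le> (real N + 1) ^ (2 * m) * (D * (1 + q)) ^ (2 * m)"
  proof (rule mult_right_mono)
    have "real N + 1 \<le> (real N + 1) ^ (2 * m)"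
      using assms by (intro self_le_power) auto
    then show "real N \<le> (real N + 1) ^ (2 * m)"
      by simp
  qed simp
  finally show "(\<Sum>k<N. (1 + c k * q) ^ (2 * m)) \<le> ((real N + 1) * D * (1 + q)) ^ (2 * m)"
    by (simp add: power_mult_distrib)
qed

text \<open>Even powers cannot cancel, so each summand is at most the whole sum.\<close>

lemma abs_le_of_sum_even_powers:
  fixes h :: "'a \<Rightarrow> real"
  assumes "(\<Sum>k\<in>A. h k ^ (2 * m)) \<le> B ^ (2 * m)" "0 \<le> B" "0 < m" "finite A" "k \<in> A"
  shows "\<bar>h k\<bar> \<le> B"
proof -
  have "h k ^ (2 * m) \<le> (\<Sum>k\<in>A. h k ^ (2 * m))"
    using assms(4,5) by (intro member_le_sum) (auto simp: zero_le_even_power)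
  with assms(1) have "\<bar>h k\<bar> ^ (2 * m) \<le> B ^ (2 * m)"
    by (simp add: power_even_abs)
  then show ?thesis
    using assms(2,3) by (simp add: power_mono_iff)
qed

text \<open>
  The coefficients of degrees $2s - 2$, $2s - 1$, $2s$ yield
  $\sum_k \beta_k^{2s-2} (\beta_k - \alpha_k)^2 = j - 2j + j = 0$. This is where $s > 1$ enters: the
  coefficient of degree $0$ is not controlled by $j$.
\<close>

lemma sum_linear_powers_rigid:
  fixes \<alpha> \<beta> :: "'a \<Rightarrow> real"
  assumes s: "s > 1" and A: "finite A"
    and eq: "(\<Sum>k\<in>A. [:\<alpha> k, \<beta> k:] ^ (2 * s)) = smult j ([:1, 1:] ^ (2 * s)) + [:c:]"
    and k: "k \<in> A"
  shows "\<beta> k = 0 \<or> \<beta> k = \<alpha> k"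
proof -
  \<comment> \<open>For \<open>i > 0\<close> the constant \<open>c\<close> does not contribute, and
    the binomial coefficient cancels from both sides.\<close>
  have moment: "(\<Sum>k\<in>A. \<beta> k ^ i * \<alpha> k ^ (2 * s - i)) = j" if i: "0 < i" "i \<le> 2 * s" for i
  proof -
    have "real (2 * s choose i) * (\<Sum>k\<in>A. \<beta> k ^ i * \<alpha> k ^ (2 * s - i))
        = coeff (\<Sum>k\<in>A. [:\<alpha> k, \<beta> k:] ^ (2 * s)) i"
      using i by (simp add: coeff_sum coeff_linear_poly_power sum_distrib_left mult.assoc)
    also have "\<dots> = real (2 * s choose i) * j"
      unfolding eq using i by (simp add: coeff_linear_poly_power coeff_pCons split: nat.split)
    finally show ?thesis
      using i by simp
  qed
  let ?T = "\<lambda>k. \<beta> k ^ (2 * s - 2) * (\<beta> k - \<alpha> k) ^ 2"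
  \<comment> \<open>The exponents keep the shape in which \<open>moment\<close> gives them for
    \<open>i\<close> equal to \<open>2 * s\<close>, \<open>2 * s - 1\<close> and
    \<open>2 * s - 2\<close>.\<close>
  have expand: "?T k = \<beta> k ^ (2 * s) * \<alpha> k ^ (2 * s - 2 * s)
      - 2 * (\<beta> k ^ (2 * s - 1) * \<alpha> k ^ (2 * s - (2 * s - 1)))
      + \<beta> k ^ (2 * s - 2) * \<alpha> k ^ (2 * s - (2 * s - 2))" for k
  proof -
    obtain m where "2 * s = m + 2"
      using s that[of "2 * s - 2"] by simp
    then show ?thesis
      by (simp add: power2_eq_square algebra_simps power_add)
  qed
  have "(\<Sum>k\<in>A. ?T k) = j - 2 * j + j"
    unfolding expand sum.distrib sum_subtractf sum_distrib_left[symmetric]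
    using moment[of "2 * s"] moment[of "2 * s - 1"] moment[of "2 * s - 2"] s by simp
  then have "(\<Sum>k\<in>A. ?T k) = 0"
    by simp
  moreover have "0 \<le> ?T k" for k
    by (simp add: zero_le_even_power)
  ultimately have "?T k = 0"
    using A k by (simp add: sum_nonneg_eq_0_iff)
  then show ?thesis
    by auto
qed

text \<open>The sets \<open>Z j\<close> for \<open>j \<le> N\<close> are distinct, because
  \<open>j\<close> can be recovered from \<open>Z j\<close> as a sum; so there are
  \<open>N + 1\<close> subsets of \<open>g\<close> indices. The identity is assumed for large
  \<open>q\<close> only, since real points of the extension are guaranteed only there.\<close>

lemma sum_of_powers_length_bound:
  fixes H :: "nat \<Rightarrow> real poly poly" and b :: "nat \<Rightarrow> real poly"
  assumes s: "s > 1"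
    and eq: "\<And>p. \<forall>\<^sub>F q in at_top.
      (\<Sum>k<g. eval2 (H k) p q ^ (2 * s)) = (\<Sum>k<N. (1 + poly (b k) p * q) ^ (2 * s))"
    and b: "\<And>j k. j \<le> N \<Longrightarrow> k < N \<Longrightarrow> poly (b k) (real j) = (if k < j then 1 else 0)"
  shows "N < 2 ^ g"
proof -
  define h where "h k p = map_poly (\<lambda>a. poly a p) (H k)" for k p
  have h_eval: "eval2 (H k) p q = poly (h k p) q" for k p q
    by (simp add: h_def eval2_map_poly)
  have h_coeff: "coeff (h k p) i = poly (coeff (H k) i) p" for k p i
    by (simp add: h_def coeff_map_poly)
  \<comment> \<open>For fixed \<open>p\<close>, equality for large \<open>q\<close> is an identity
    of polynomials in \<open>q\<close>, so it also holds at \<open>q = 0\<close>.\<close>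
  have h_sum: "(\<Sum>k<g. h k p ^ (2 * s)) = (\<Sum>k<N. [:1, poly (b k) p:] ^ (2 * s))" for p
  proof (rule poly_eq_of_eventually_eq)
    show "\<forall>\<^sub>F q in at_top. poly (\<Sum>k<g. h k p ^ (2 * s)) q
        = poly (\<Sum>k<N. [:1, poly (b k) p:] ^ (2 * s)) q"
      using eq[of p] by eventually_elim (simp add: poly_sum h_eval mult.commute)
  qed
  have h_sum_eval: "(\<Sum>k<g. poly (h k p) q ^ (2 * s)) = (\<Sum>k<N. (1 + poly (b k) p * q) ^ (2 * s))"
    for p q
    using arg_cong[OF h_sum[of p], of "\<lambda>r. poly r q"] by (simp add: poly_sum mult.commute)
  \<comment> \<open>The sum is at most the power of a linear function of \<open>q\<close> and its
    summands cannot cancel, so each \<open>h k p\<close> grows at most linearly.\<close>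
  have h_linear: "h k p = [:poly (coeff (H k) 0) p, poly (coeff (H k) 1) p:]" if k: "k < g" for k p
  proof -
    obtain C where C: "\<And>q. 0 \<le> q \<Longrightarrow>
        (\<Sum>k<N. (1 + poly (b k) p * q) ^ (2 * s)) \<le> (C * (1 + q)) ^ (2 * s)" "0 \<le> C"
      by (rule linear_powers_bound[where m = s and N = N and c = "\<lambda>k. poly (b k) p"]) (use s in auto)
    have "\<forall>\<^sub>F q in at_top. \<bar>poly (h k p) q\<bar> \<le> (2 * C) * q ^ 1"
      using eventually_ge_at_top[of 1]
    proof eventually_elim
      case (elim q)
      have "\<bar>poly (h k p) q\<bar> \<le> C * (1 + q)"
        using C elim s k
        by (intro abs_le_of_sum_even_powers[where A = "{..<g}" and m = s]) (auto simp: h_sum_eval)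
      also have "\<dots> \<le> C * (2 * q)"
        using C elim by (intro mult_left_mono) auto
      finally show ?case
        by simp
    qed
    then have "degree (h k p) \<le> 1"
      by (rule degree_le_of_growth)
    then show ?thesis
      unfolding poly_eq_iff
      by (auto simp: coeff_pCons h_coeff[symmetric] coeff_eq_0 split: nat.split)
  qed
  \<comment> \<open>At \<open>q = 0\<close> the sum equals \<open>N\<close> for every
    \<open>p\<close>. Thus the coefficient of \<open>q ^ 0\<close> is bounded in \<open>p\<close>,
    hence constant.\<close>
  have const: "degree (coeff (H k) 0) = 0" if k: "k < g" for k
  proof -
    have "\<bar>poly (coeff (H k) 0) p\<bar> \<le> real N + 1" for p
    proof -
      have "real N + 1 \<le> (real N + 1) ^ (2 * s)"
        using s by (intro self_le_power) auto
      then have "(\<Sum>k<g. poly (h k p) 0 ^ (2 * s)) \<le> (real N + 1) ^ (2 * s)"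
        unfolding h_sum_eval by simp
      then have "\<bar>poly (h k p) 0\<bar> \<le> real N + 1"
        using s k by (intro abs_le_of_sum_even_powers[where A = "{..<g}" and m = s]) auto
      then show ?thesis
        by (simp add: poly_0_coeff_0 h_coeff)
    qed
    then have "\<forall>\<^sub>F p in at_top. \<bar>poly (coeff (H k) 0) p\<bar> \<le> (real N + 1) * p ^ 0"
      by simp
    then show ?thesis
      using degree_le_of_growth by blast
  qed
  define \<alpha> where "\<alpha> k = coeff (coeff (H k) 0) 0" for k
  define \<beta> where "\<beta> k j = poly (coeff (H k) 1) (real j)" for k j :: nat
  have \<alpha>: "poly (coeff (H k) 0) p = \<alpha> k" if "k < g" for k p
    using const[OF that] by (auto simp: \<alpha>_def elim!: degree_eq_zeroE)
  have count: "(\<Sum>k<N. if k < j then x else (y :: real poly)) = of_nat j * x + of_nat (N - j) * y"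
    if "j \<le> N" for j x y
  proof -
    have "{..<N} \<inter> {k. k < j} = {..<j}" "{..<N} \<inter> - {k. k < j} = {j..<N}"
      using that by auto
    then show ?thesis
      by (simp add: sum.If_cases)
  qed
  \<comment> \<open>On the line \<open>p = j\<close> the first \<open>j\<close> summands become
    \<open>(1 + q) ^ (2 * s)\<close> and the others 1, the shape required by
    \<open>sum_linear_powers_rigid\<close>.\<close>
  have fibre: "(\<Sum>k<g. [:\<alpha> k, \<beta> k j:] ^ (2 * s))
      = smult (real j) ([:1, 1:] ^ (2 * s)) + [:real (N - j):]" if j: "j \<le> N" for j
  proof -
    have "(\<Sum>k<g. [:\<alpha> k, \<beta> k j:] ^ (2 * s)) = (\<Sum>k<g. h k (real j) ^ (2 * s))"
      by (intro sum.cong) (simp_all add: h_linear \<alpha> \<beta>_def)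
    also have "\<dots> = (\<Sum>k<N. if k < j then [:1, 1:] ^ (2 * s) else 1)"
      unfolding h_sum using j b by (intro sum.cong) (auto simp: pCons_one)
    also have "\<dots> = of_nat j * [:1, 1:] ^ (2 * s) + of_nat (N - j) * 1"
      by (rule count[OF j])
    finally show ?thesis
      by (simp add: of_nat_poly)
  qed
  define Z where "Z j = {k \<in> {..<g}. \<beta> k j \<noteq> 0}" for j
  \<comment> \<open>Compare coefficients of \<open>q ^ (2 * s)\<close>. Rigidity replaces each
    nonzero \<open>\<beta> k j\<close> by \<open>\<alpha> k\<close>, so the line enters only through
    the set \<open>Z j\<close>.\<close>
  have mass: "real j = (\<Sum>k\<in>Z j. \<alpha> k ^ (2 * s))" if j: "j \<le> N" for j
  proof -
    have "coeff (\<Sum>k<g. [:\<alpha> k, \<beta> k j:] ^ (2 * s)) (2 * s) = (\<Sum>k<g. \<beta> k j ^ (2 * s))"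
      by (simp add: coeff_sum coeff_linear_poly_power)
    then have "real j = (\<Sum>k<g. \<beta> k j ^ (2 * s))"
      using s unfolding fibre[OF j]
      by (simp add: coeff_linear_poly_power coeff_pCons split: nat.splits)
    also have "\<dots> = (\<Sum>k\<in>Z j. \<beta> k j ^ (2 * s))"
      using s by (intro sum.mono_neutral_right) (auto simp: Z_def)
    also have "\<dots> = (\<Sum>k\<in>Z j. \<alpha> k ^ (2 * s))"
    proof (rule sum.cong)
      fix k
      assume "k \<in> Z j"
      then have "\<beta> k j = \<alpha> k"
        using sum_linear_powers_rigid[OF s _ fibre[OF j], of k] by (simp add: Z_def)
      then show "\<beta> k j ^ (2 * s) = \<alpha> k ^ (2 * s)"
        by simp
    qed simp
    finally show ?thesis .
  qed
  have "inj_on Z {..N}"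
    using mass by (intro inj_onI) (metis atMost_iff of_nat_eq_iff)
  then have "card {..N} \<le> card (Pow {..<g})"
    by (rule card_inj_on_le) (auto simp: Z_def)
  then show ?thesis
    by (simp add: card_Pow)
qed


subsection \<open>Separating the sign patterns of the square roots\<close>

text \<open>Induction on \<open>A\<close>: fixing the sign of \<open>a\<close> to \<open>e\<close>
  merges \<open>w I\<close> and \<open>w (insert a I)\<close> into
  \<open>w I + e * w (insert a I)\<close>. If the sum and the difference of two reals are both
  bounded by \<open>K\<close>, so is each of them.\<close>

lemma abs_le_of_signed_sums:
  fixes w :: "'a set \<Rightarrow> real"
  assumes "finite A"
    and "\<And>\<sigma>. (\<And>i. \<sigma> i = 1 \<or> \<sigma> i = - 1) \<Longrightarrow> \<bar>\<Sum>I\<in>Pow A. (\<Prod>i\<in>I. \<sigma> i) * w I\<bar> \<le> K"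
    and "J \<subseteq> A"
  shows "\<bar>w J\<bar> \<le> K"
  using assms
proof (induction A arbitrary: w J)
  case empty
  then show ?case
    using empty.prems(1)[of "\<lambda>_. 1"] by simp
next
  case (insert a A)
  have inj: "inj_on (insert a) (Pow A)"
    using insert.hyps by (auto simp: inj_on_def)
  have both: "\<bar>w I + e * w (insert a I)\<bar> \<le> K" if I: "I \<subseteq> A" and e: "e = 1 \<or> e = - 1" for I e
  proof (rule insert.IH[OF _ I])
    fix \<sigma> :: "'a \<Rightarrow> real"
    assume \<sigma>: "\<And>i. \<sigma> i = 1 \<or> \<sigma> i = - 1"
    let ?\<tau> = "\<sigma>(a := e)"
    have \<tau>: "(\<Prod>i\<in>I. ?\<tau> i) = (\<Prod>i\<in>I. \<sigma> i)" "(\<Prod>i\<in>insert a I. ?\<tau> i) = e * (\<Prod>i\<in>I. \<sigma> i)"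
      if "I \<subseteq> A" for I
    proof -
      have "a \<notin> I" "finite I"
        using that insert.hyps finite_subset by auto
      moreover from \<open>a \<notin> I\<close> show "(\<Prod>i\<in>I. ?\<tau> i) = (\<Prod>i\<in>I. \<sigma> i)"
        by (intro prod.cong) auto
      ultimately show "(\<Prod>i\<in>insert a I. ?\<tau> i) = e * (\<Prod>i\<in>I. \<sigma> i)"
        by simp
    qed
    have "(\<Sum>I\<in>Pow (insert a A). (\<Prod>i\<in>I. ?\<tau> i) * w I)
        = (\<Sum>I\<in>Pow A. (\<Prod>i\<in>I. ?\<tau> i) * w I)
          + (\<Sum>I\<in>Pow A. (\<Prod>i\<in>insert a I. ?\<tau> i) * w (insert a I))"
      unfolding Pow_insert using insert.hyps
      by (subst sum.union_disjoint) (auto simp: sum.reindex[OF inj])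
    also have "\<dots> = (\<Sum>I\<in>Pow A. (\<Prod>i\<in>I. \<sigma> i) * (w I + e * w (insert a I)))"
      using \<tau> by (simp add: sum.distrib[symmetric] algebra_simps)
    finally show "\<bar>\<Sum>I\<in>Pow A. (\<Prod>i\<in>I. \<sigma> i) * (w I + e * w (insert a I))\<bar> \<le> K"
      using insert.prems(1)[of ?\<tau>] \<sigma> e by auto
  qed
  have "\<bar>w I\<bar> \<le> K \<and> \<bar>w (insert a I)\<bar> \<le> K" if "I \<subseteq> A" for I
    using both[OF that, of 1] both[OF that, of "- 1"] by auto
  moreover have "J \<subseteq> A \<or> (\<exists>I \<subseteq> A. J = insert a I)"
    using insert.prems(2) by (metis subset_insert_iff insert_Diff)
  ultimately show ?case
    by blast
qed

subsection \<open>Real points of the extension ring\<close>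

text \<open>Evaluation at a point, with \<open>z_var i\<close> sent to \<open>r i\<close>. Variables
  outside \<open>{1..n}\<close> are sent to 1, so this is a ring homomorphism on the whole type and
  not only on the carrier.\<close>

definition eval_z ::
    "nat \<Rightarrow> real \<Rightarrow> real \<Rightarrow> (nat \<Rightarrow> real) \<Rightarrow> ((nat \<Rightarrow>\<^sub>0 nat) \<Rightarrow>\<^sub>0 real poly poly) \<Rightarrow> real" where
  "eval_z n x y r P = (\<Sum>m\<in>Poly_Mapping.keys P.
     eval2 (Poly_Mapping.lookup P m) x y * (\<Prod>i\<in>{1..n}. r i ^ Poly_Mapping.lookup m i))"

lemma eval_z_superset:
  assumes "finite A" "Poly_Mapping.keys P \<subseteq> A"
  shows "eval_z n x y r P =
    (\<Sum>m\<in>A. eval2 (Poly_Mapping.lookup P m) x y * (\<Prod>i\<in>{1..n}. r i ^ Poly_Mapping.lookup m i))"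
  unfolding eval_z_def using assms by (intro sum.mono_neutral_left) (auto simp: in_keys_iff)

lemma eval_z_0 [simp]: "eval_z n x y r 0 = 0"
  by (simp add: eval_z_def)

lemma eval_z_single:
  "eval_z n x y r (Poly_Mapping.single m c)
    = eval2 c x y * (\<Prod>i\<in>{1..n}. r i ^ Poly_Mapping.lookup m i)"
  by (subst eval_z_superset[of "{m}"]) auto

lemma eval_z_add: "eval_z n x y r (P + Q) = eval_z n x y r P + eval_z n x y r Q"
proof -
  let ?A = "Poly_Mapping.keys P \<union> Poly_Mapping.keys Q"
  have "Poly_Mapping.keys (P + Q) \<subseteq> ?A"
    by (rule Poly_Mapping.keys_add)
  then show ?thesis
    by (simp add: eval_z_superset[of ?A] lookup_add sum.distrib algebra_simps)
qed

lemma eval_z_sum: "eval_z n x y r (sum P A) = (\<Sum>a\<in>A. eval_z n x y r (P a))"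
  by (induction A rule: infinite_finite_induct) (simp_all add: eval_z_add)

lemma poly_mapping_sum_singles:
  "P = (\<Sum>m\<in>Poly_Mapping.keys P. Poly_Mapping.single m (Poly_Mapping.lookup P m))"
  by (rule poly_mapping_eqI)
    (auto simp: lookup_sum lookup_single when_def in_keys_iff)

text \<open>Expanding both factors into monomials reduces the claim to the addition of
  exponents.\<close>

lemma eval_z_mult: "eval_z n x y r (P * Q) = eval_z n x y r P * eval_z n x y r Q"
proof -
  have "P * Q = (\<Sum>m\<in>Poly_Mapping.keys P. \<Sum>m'\<in>Poly_Mapping.keys Q.
      Poly_Mapping.single (m + m') (Poly_Mapping.lookup P m * Poly_Mapping.lookup Q m'))"
    by (subst poly_mapping_sum_singles[of P], subst poly_mapping_sum_singles[of Q])
      (simp add: sum_product mult_single)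
  then show ?thesis
    by (simp add: eval_z_sum eval_z_single lookup_add power_add prod.distrib)
      (simp add: eval_z_def sum_product algebra_simps)
qed

lemma eval_z_z_const [simp]: "eval_z n x y r (z_const c) = eval2 c x y"
  by (simp add: z_const_def eval_z_single)

lemma z_const_mult: "z_const (a * b) = z_const a * z_const b"
  by (simp add: z_const_def mult_single)

lemma z_const_power: "z_const (a ^ k) = z_const a ^ k"
  by (induction k) (simp_all add: z_const_mult, simp add: z_const_def)

lemma z_const_sum: "z_const (sum a A) = (\<Sum>i\<in>A. z_const (a i))"
  by (induction A rule: infinite_finite_induct) (simp_all add: z_const_def single_add)

lemma eval_z_1 [simp]: "eval_z n x y r 1 = 1"
  using eval_z_z_const[of n x y r 1] by (simp add: z_const_def)

lemma eval_z_power: "eval_z n x y r (P ^ k) = eval_z n x y r P ^ k"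
  by (induction k) (simp_all add: eval_z_mult)

lemma eval_z_uminus: "eval_z n x y r (- P) = - eval_z n x y r P"
  using eval_z_add[of n x y r P "- P"] by simp

lemma eval_z_diff: "eval_z n x y r (P - Q) = eval_z n x y r P - eval_z n x y r Q"
  using eval_z_add[of n x y r P "- Q"] by (simp add: eval_z_uminus)

lemma eval_z_z_var: "i \<in> {1..n} \<Longrightarrow> eval_z n x y r (z_var i) = r i"
  by (simp add: z_var_def eval_z_single lookup_single when_def if_distrib[of "\<lambda>e. r _ ^ e"]
      cong: if_cong)

section \<open>Cosets modulo the relations and their values at real points\<close>

definition relation_ideal ::
    "nat \<Rightarrow> (nat \<Rightarrow> real poly poly) \<Rightarrow> ((nat \<Rightarrow>\<^sub>0 nat) \<Rightarrow>\<^sub>0 real poly poly) set" where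
  "relation_ideal n f = Idl\<^bsub>poly_ring_z n\<^esub> ((\<lambda>i. z_var i ^ 2 - z_const (f i)) ` {1..n})"

lemma sqrt_ext_ring_quot: "sqrt_ext_ring n f = poly_ring_z n Quot relation_ideal n f"
  by (simp add: sqrt_ext_ring_def relation_ideal_def)

lemma carrier_sqrt_ext_ring:
  "carrier (sqrt_ext_ring n f)
    = (\<lambda>P. relation_ideal n f +>\<^bsub>poly_ring_z n\<^esub> P) ` carrier (poly_ring_z n)"
  by (auto simp: sqrt_ext_ring_quot FactRing_def A_RCOSETS_def')

lemma poly_ring_z_a_inv:
  assumes "P \<in> carrier (poly_ring_z n)"
  shows "\<ominus>\<^bsub>poly_ring_z n\<^esub> P = - P"
proof -
  interpret cring "poly_ring_z n"
    by (rule cring_poly_ring_z)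
  have "- P \<in> carrier (poly_ring_z n)"
    using assms by (auto simp: poly_ring_z_def in_keys_iff)
  with assms show ?thesis
    by (intro minus_equality) (simp_all add: poly_ring_z_ops)
qed

lemma poly_ring_z_diff_closed:
  assumes "P \<in> carrier (poly_ring_z n)" "Q \<in> carrier (poly_ring_z n)"
  shows "P - Q \<in> carrier (poly_ring_z n)"
proof -
  interpret cring "poly_ring_z n"
    by (rule cring_poly_ring_z)
  show ?thesis
    using minus_closed[OF assms] assms(2) by (simp add: a_minus_def poly_ring_z_a_inv poly_ring_z_ops)
qed

lemma poly_ring_z_nat_pow: "P [^]\<^bsub>poly_ring_z n\<^esub> (k::nat) = P ^ k"
  by (induction k) (simp_all add: poly_ring_z_ops nat_pow_def mult.commute)

lemma poly_ring_z_finsum: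
  assumes "P \<in> A \<rightarrow> carrier (poly_ring_z n)" "finite A"
  shows "(\<Oplus>\<^bsub>poly_ring_z n\<^esub>a\<in>A. P a) = (\<Sum>a\<in>A. P a)"
proof -
  interpret cring "poly_ring_z n"
    by (rule cring_poly_ring_z)
  show ?thesis
    using assms(2,1) by induction (simp_all add: poly_ring_z_ops)
qed

lemma relation_closed:
  assumes "i \<in> {1..n}"
  shows "z_var i ^ 2 - z_const (f i) \<in> carrier (poly_ring_z n)"
proof -
  interpret cring "poly_ring_z n"
    by (rule cring_poly_ring_z)
  have "z_var i ^ 2 \<in> carrier (poly_ring_z n)"
    using nat_pow_closed[OF z_var_closed[OF assms], of 2] by (simp add: poly_ring_z_nat_pow)
  then show ?thesis
    by (intro poly_ring_z_diff_closed z_const_closed)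
qed

lemma ideal_relation_ideal: "ideal (relation_ideal n f) (poly_ring_z n)"
proof -
  interpret cring "poly_ring_z n"
    by (rule cring_poly_ring_z)
  show ?thesis
    unfolding relation_ideal_def by (rule genideal_ideal) (auto intro: relation_closed)
qed

text \<open>The kernel of the evaluation, cut down to the carrier, is an ideal containing the
  generators, so it contains the ideal they generate. Evaluation thus descends to the
  quotient.\<close>

lemma eval_z_relation_ideal:
  assumes r: "\<And>i. i \<in> {1..n} \<Longrightarrow> r i ^ 2 = eval2 (f i) x y"
    and P: "P \<in> relation_ideal n f"
  shows "eval_z n x y r P = 0"
proof -
  interpret cring "poly_ring_z n"
    by (rule cring_poly_ring_z)
  let ?K = "{P \<in> carrier (poly_ring_z n). eval_z n x y r P = 0}"
  have "ideal ?K (poly_ring_z n)"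
  proof (rule idealI)
    show "subgroup ?K (add_monoid (poly_ring_z n))"
    proof (rule add.subgroupI)
      show "?K \<noteq> {}"
        using zero_closed by (auto simp: poly_ring_z_ops)
    qed (auto simp: poly_ring_z_ops[symmetric] poly_ring_z_a_inv eval_z_uminus,
         auto simp: poly_ring_z_ops poly_ring_z_a_inv[symmetric] eval_z_add eval_z_uminus)
  qed (use m_closed in \<open>auto simp: poly_ring_z_ops eval_z_mult intro: ring_axioms\<close>)
  moreover have "(\<lambda>i. z_var i ^ 2 - z_const (f i)) ` {1..n} \<subseteq> ?K"
    using r relation_closed by (auto simp: eval_z_diff eval_z_power eval_z_z_var)
  ultimately show ?thesis
    using P genideal_minimal[of ?K] unfolding relation_ideal_def by blast
qed

text \<open>The coset map is a ring homomorphism, so a sum of powers of polynomials in x and y stays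
  one in the extension.\<close>

lemma sum_of_powers_coset:
  "sum_of_powers (sqrt_ext_ring n f) k l
     (relation_ideal n f +>\<^bsub>poly_ring_z n\<^esub> z_const (\<Sum>j<l. w j ^ k))"
proof -
  interpret I: ideal "relation_ideal n f" "poly_ring_z n"
    by (rule ideal_relation_ideal)
  interpret h: ring_hom_ring "poly_ring_z n" "sqrt_ext_ring n f"
    "(+>\<^bsub>poly_ring_z n\<^esub>) (relation_ideal n f)"
    unfolding sqrt_ext_ring_quot by (rule I.rcos_ring_hom_ring)
  interpret hc: ring_hom_cring "poly_ring_z n" "sqrt_ext_ring n f"
    "(+>\<^bsub>poly_ring_z n\<^esub>) (relation_ideal n f)"
    unfolding sqrt_ext_ring_quot by (rule I.rcos_ring_hom_cring[OF cring_poly_ring_z])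
  have "z_const (\<Sum>j<l. w j ^ k)
      = (\<Oplus>\<^bsub>poly_ring_z n\<^esub>j\<in>{..<l}. z_const (w j) [^]\<^bsub>poly_ring_z n\<^esub> k)"
    using z_const_closed[of "w _ ^ k" n]
    by (subst poly_ring_z_finsum)
      (auto simp: poly_ring_z_nat_pow z_const_sum simp flip: z_const_power)
  then have "relation_ideal n f +>\<^bsub>poly_ring_z n\<^esub> z_const (\<Sum>j<l. w j ^ k)
      = (\<Oplus>\<^bsub>sqrt_ext_ring n f\<^esub>j\<in>{..<l}.
          relation_ideal n f +>\<^bsub>poly_ring_z n\<^esub> (z_const (w j) [^]\<^bsub>poly_ring_z n\<^esub> k))"
    using z_const_closed by (simp add: hc.hom_finsum o_def)
  then show ?thesis
    unfolding sum_of_powers_def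
    by (intro exI[of _ "\<lambda>j. relation_ideal n f +>\<^bsub>poly_ring_z n\<^esub> z_const (w j)"])
      (simp add: z_const_closed h.hom_nat_pow)
qed

text \<open>Lift the summands to representatives: the resulting identity holds up to an element of
  the ideal, which vanishes at real points. Only the values there are kept, as the growth argument
  needs no more.\<close>

lemma sum_of_powers_cosetD:
  assumes "sum_of_powers (sqrt_ext_ring n f) k l (relation_ideal n f +>\<^bsub>poly_ring_z n\<^esub> z_const F)"
  obtains B where "\<And>x y r. (\<And>i. i \<in> {1..n} \<Longrightarrow> r i ^ 2 = eval2 (f i) x y) \<Longrightarrow>
    (\<Sum>j<l. eval_z n x y r (B j) ^ k) = eval2 F x y"
proof -
  interpret cring "poly_ring_z n"
    by (rule cring_poly_ring_z)
  interpret I: ideal "relation_ideal n f" "poly_ring_z n"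
    by (rule ideal_relation_ideal)
  interpret h: ring_hom_ring "poly_ring_z n" "sqrt_ext_ring n f"
    "(+>\<^bsub>poly_ring_z n\<^esub>) (relation_ideal n f)"
    unfolding sqrt_ext_ring_quot by (rule I.rcos_ring_hom_ring)
  interpret hc: ring_hom_cring "poly_ring_z n" "sqrt_ext_ring n f"
    "(+>\<^bsub>poly_ring_z n\<^esub>) (relation_ideal n f)"
    unfolding sqrt_ext_ring_quot by (rule I.rcos_ring_hom_cring[OF cring_poly_ring_z])
  from assms obtain b where b: "b \<in> {..<l} \<rightarrow> carrier (sqrt_ext_ring n f)"
    and sum_b: "relation_ideal n f +>\<^bsub>poly_ring_z n\<^esub> z_const F
      = (\<Oplus>\<^bsub>sqrt_ext_ring n f\<^esub>j\<in>{..<l}. b j [^]\<^bsub>sqrt_ext_ring n f\<^esub> k)"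
    by (auto simp: sum_of_powers_def)
  have "\<exists>P. P \<in> carrier (poly_ring_z n) \<and> b j = relation_ideal n f +>\<^bsub>poly_ring_z n\<^esub> P"
    if "j < l" for j
  proof -
    have "b j \<in> carrier (sqrt_ext_ring n f)"
      using b that by blast
    then show ?thesis
      unfolding carrier_sqrt_ext_ring by blast
  qed
  then obtain B where B: "\<And>j. j < l \<Longrightarrow> B j \<in> carrier (poly_ring_z n)"
    "\<And>j. j < l \<Longrightarrow> b j = relation_ideal n f +>\<^bsub>poly_ring_z n\<^esub> B j"
    by metis
  have pow_closed: "B j ^ k \<in> carrier (poly_ring_z n)" if "j < l" for j
    using nat_pow_closed[OF B(1)[OF that], of k] by (simp add: poly_ring_z_nat_pow)
  have sum_closed: "(\<Sum>j<l. B j ^ k) \<in> carrier (poly_ring_z n)"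
    using finsum_closed[of "\<lambda>j. B j ^ k" "{..<l}"] pow_closed
    by (simp add: Pi_def poly_ring_z_finsum)
  have "(\<Oplus>\<^bsub>sqrt_ext_ring n f\<^esub>j\<in>{..<l}. b j [^]\<^bsub>sqrt_ext_ring n f\<^esub> k)
      = (\<Oplus>\<^bsub>sqrt_ext_ring n f\<^esub>j\<in>{..<l}. relation_ideal n f +>\<^bsub>poly_ring_z n\<^esub> (B j ^ k))"
  proof (rule h.S.finsum_cong')
    show "(\<lambda>j. relation_ideal n f +>\<^bsub>poly_ring_z n\<^esub> (B j ^ k)) \<in> {..<l} \<rightarrow> carrier (sqrt_ext_ring n f)"
      using pow_closed h.hom_closed by blast
    show "b j [^]\<^bsub>sqrt_ext_ring n f\<^esub> k = relation_ideal n f +>\<^bsub>poly_ring_z n\<^esub> (B j ^ k)"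
      if "j \<in> {..<l}" for j
      using h.hom_nat_pow[OF B(1)[of j], of k] B(2)[of j] that
      by (simp only: lessThan_iff poly_ring_z_nat_pow)
  qed simp
  also have "\<dots> = relation_ideal n f +>\<^bsub>poly_ring_z n\<^esub> (\<Oplus>\<^bsub>poly_ring_z n\<^esub>j\<in>{..<l}. B j ^ k)"
    using pow_closed by (subst hc.hom_finsum) (auto simp: o_def)
  also have "(\<Oplus>\<^bsub>poly_ring_z n\<^esub>j\<in>{..<l}. B j ^ k) = (\<Sum>j<l. B j ^ k)"
    using pow_closed by (intro poly_ring_z_finsum) auto
  finally have "z_const F \<ominus>\<^bsub>poly_ring_z n\<^esub> (\<Sum>j<l. B j ^ k) \<in> relation_ideal n f"
    using sum_b quotient_eq_iff_same_a_r_cos[OF ideal_relation_ideal z_const_closed sum_closed]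
    by simp
  then have in_ideal: "z_const F - (\<Sum>j<l. B j ^ k) \<in> relation_ideal n f"
    using sum_closed by (simp add: a_minus_def poly_ring_z_a_inv poly_ring_z_ops)
  show ?thesis
  proof (rule that)
    fix x y r
    assume r: "\<And>i. i \<in> {1..n} \<Longrightarrow> r i ^ 2 = eval2 (f i) x y"
    have "eval_z n x y r (z_const F - (\<Sum>j<l. B j ^ k)) = 0"
      by (rule eval_z_relation_ideal[OF r in_ideal])
    then show "(\<Sum>j<l. eval_z n x y r (B j) ^ k) = eval2 F x y"
      by (simp add: eval_z_diff eval_z_sum eval_z_power)
  qed
qed

section \<open>Components along products of square roots\<close>

definition odd_part ::
    "nat \<Rightarrow> (nat \<Rightarrow> real poly poly) \<Rightarrow> ((nat \<Rightarrow>\<^sub>0 nat) \<Rightarrow>\<^sub>0 real poly poly) \<Rightarrow> nat set \<Rightarrow> real poly poly" where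
  "odd_part n f P I =
     (\<Sum>m | m \<in> Poly_Mapping.keys P \<and> {i \<in> {1..n}. odd (Poly_Mapping.lookup m i)} = I.
        Poly_Mapping.lookup P m * (\<Prod>i\<in>{1..n}. f i ^ (Poly_Mapping.lookup m i div 2)))"

text \<open>Replacing squares of the variables by the \<open>f i\<close> leaves square-free
  monomials, sorted by their set \<open>I\<close> of odd exponents; for \<open>P\<close> in the
  carrier, \<open>odd_part n f P I\<close> is the resulting coefficient of the product of the
  \<open>z_var i\<close> over \<open>I\<close>.\<close>

lemma eval_z_odd_parts:
  assumes r: "\<And>i. i \<in> {1..n} \<Longrightarrow> r i ^ 2 = eval2 (f i) x y"
  shows "eval_z n x y r P = (\<Sum>I\<in>Pow {1..n}. (\<Prod>i\<in>I. r i) * eval2 (odd_part n f P I) x y)"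
proof -
  let ?odd = "\<lambda>m. {i \<in> {1..n}. odd (Poly_Mapping.lookup m i)}"
  let ?c = "\<lambda>m. eval2 (Poly_Mapping.lookup P m) x y
    * (\<Prod>i\<in>{1..n}. eval2 (f i) x y ^ (Poly_Mapping.lookup m i div 2))"
  have monomial: "(\<Prod>i\<in>{1..n}. r i ^ Poly_Mapping.lookup m i)
      = (\<Prod>i\<in>{1..n}. eval2 (f i) x y ^ (Poly_Mapping.lookup m i div 2)) * (\<Prod>i\<in>?odd m. r i)" for m
  proof -
    have "r i ^ e = eval2 (f i) x y ^ (e div 2) * (if odd e then r i else 1)" if "i \<in> {1..n}" for i e
    proof -
      have "r i ^ e = (r i ^ 2) ^ (e div 2) * r i ^ (e mod 2)"
        by (simp flip: power_mult power_add)
      then show ?thesis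
        using r[OF that] by (simp add: mod2_eq_if)
    qed
    then have "(\<Prod>i\<in>{1..n}. r i ^ Poly_Mapping.lookup m i)
        = (\<Prod>i\<in>{1..n}. eval2 (f i) x y ^ (Poly_Mapping.lookup m i div 2)
            * (if odd (Poly_Mapping.lookup m i) then r i else 1))"
      by (intro prod.cong) auto
    then show ?thesis
      by (simp only: prod.inter_filter[OF finite_atLeastAtMost] prod.distrib)
  qed
  have "eval_z n x y r P = (\<Sum>m\<in>Poly_Mapping.keys P. (\<Prod>i\<in>?odd m. r i) * ?c m)"
    unfolding eval_z_def monomial by (simp add: mult_ac)
  also have "\<dots> = (\<Sum>I\<in>Pow {1..n}. \<Sum>m | m \<in> Poly_Mapping.keys P \<and> ?odd m = I. (\<Prod>i\<in>?odd m. r i) * ?c m)"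
    by (rule sum.group[symmetric]) auto
  also have "\<dots> = (\<Sum>I\<in>Pow {1..n}. (\<Prod>i\<in>I. r i) * eval2 (odd_part n f P I) x y)"
    by (intro sum.cong refl)
      (simp add: odd_part_def eval2_sum eval2_prod sum_distrib_left)
  finally show ?thesis .
qed

text \<open>Signs of the roots can be chosen freely, so the growth bound passes to every component.
  One with nonempty \<open>I\<close> carries a root of some \<open>f i\<close> that outgrows
  \<open>q ^ 2\<close>, so its polynomial factor tends to 0 and vanishes. The component of the empty
  set is the required \<open>H\<close>, the same for all \<open>p\<close>.\<close>

lemma eval_z_polynomial_on_curves:
  assumes M: "\<And>i j. i \<in> {1..n} \<Longrightarrow> degree (coeff (f i) j) < M"
    and nonconst: "\<And>i. i \<in> {1..n} \<Longrightarrow> \<not> constant_poly2 (f i)"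
    and pos: "\<And>i. i \<in> {1..n} \<Longrightarrow> y_lead_coeff (f i) > 0"
    and growth: "\<And>p. \<exists>C. \<forall>\<^sub>F q in at_top. \<forall>r.
      (\<forall>i\<in>{1..n}. r i ^ 2 = eval2 (f i) (curve_x p q) (curve_y M p q)) \<longrightarrow>
      \<bar>eval_z n (curve_x p q) (curve_y M p q) r P\<bar> \<le> C * (1 + q)"
  shows "\<exists>H. \<forall>p. \<forall>\<^sub>F q in at_top. \<forall>r.
    (\<forall>i\<in>{1..n}. r i ^ 2 = eval2 (f i) (curve_x p q) (curve_y M p q)) \<longrightarrow>
    eval_z n (curve_x p q) (curve_y M p q) r P = eval2 H p q"
proof -
  \<comment> \<open>Here the inner variable stands for \<open>p\<close> and the outer one for
    \<open>q\<close>.\<close>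
  let ?X = "[:[:0, 1:]:] + [:0, 1:] ^ 3 :: real poly poly"
  let ?Y = "[:0, 1:] + ?X ^ M"
  have X: "eval2 ?X p q = curve_x p q" for p q
    by (simp add: curve_x_def)
  have Y: "eval2 ?Y p q = curve_y M p q" for p q
    by (simp add: curve_y_def X del: power_0_Suc) (simp add: curve_x_def)
  have "\<forall>I. \<exists>H. \<forall>p q. eval2 H p q = eval2 (odd_part n f P I) (curve_x p q) (curve_y M p q)"
    using eval2_compose[of "odd_part n f P _" ?X ?Y] unfolding X Y by blast
  from choice[OF this] obtain H where H: "\<And>I p q. eval2 (H I) p q
      = eval2 (odd_part n f P I) (curve_x p q) (curve_y M p q)"
    by blast
  have at_top: "filterlim (\<lambda>q. eval2 (f i) (curve_x p q) (curve_y M p q) / q ^ 2) at_top at_top"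
    if "i \<in> {1..n}" for i p
    by (rule eval2_curve_at_top) (use that M nonconst pos in auto)
  \<comment> \<open>The bound 1, stronger than positivity, later allows all factors but one to be
    dropped from a product of the \<open>f i\<close>.\<close>
  have ge_1: "\<forall>\<^sub>F q in at_top. \<forall>i\<in>{1..n}. 1 \<le> eval2 (f i) (curve_x p q) (curve_y M p q)" for p
  proof (rule eventually_ball_finite)
    show "\<forall>i\<in>{1..n}. \<forall>\<^sub>F q in at_top. 1 \<le> eval2 (f i) (curve_x p q) (curve_y M p q)"
    proof
      fix i
      assume "i \<in> {1..n}"
      then have "\<forall>\<^sub>F q in at_top. 1 \<le> eval2 (f i) (curve_x p q) (curve_y M p q) / q ^ 2"
        using filterlim_at_top[THEN iffD1, OF at_top, rule_format] by simp
      then show "\<forall>\<^sub>F q in at_top. 1 \<le> eval2 (f i) (curve_x p q) (curve_y M p q)"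
        using eventually_ge_at_top[of 1]
      proof eventually_elim
        case (elim q)
        then have "1 \<le> q ^ 2"
          by (simp add: one_le_power)
        also have "\<dots> \<le> eval2 (f i) (curve_x p q) (curve_y M p q)"
          using elim by (simp add: le_divide_eq)
        finally show ?case .
      qed
    qed
  qed simp
  have vanish: "eval2 (H I) p q = 0" if I: "I \<subseteq> {1..n}" "I \<noteq> {}" for I p q
  proof -
    obtain C where C: "\<forall>\<^sub>F q in at_top. \<forall>r.
        (\<forall>i\<in>{1..n}. r i ^ 2 = eval2 (f i) (curve_x p q) (curve_y M p q)) \<longrightarrow>
        \<bar>eval_z n (curve_x p q) (curve_y M p q) r P\<bar> \<le> C * (1 + q)"
      using growth by blast
    obtain i0 where i0: "i0 \<in> I" "i0 \<in> {1..n}"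
      using I by blast
    let ?F = "\<lambda>i q. eval2 (f i) (curve_x p q) (curve_y M p q)"
    \<comment> \<open>Squaring removes the square roots. The right side is grouped into a factor
      tending to 1 and the inverse of one tending to infinity.\<close>
    have bound: "\<forall>\<^sub>F q in at_top. eval2 (H I) p q ^ 2 \<le> C ^ 2 * ((1 + q) ^ 2 / q ^ 2) * inverse (?F i0 q / q ^ 2)"
      using C ge_1[of p] eventually_gt_at_top[of 0]
    proof eventually_elim
      case (elim q)
      \<comment> \<open>The positive roots are absorbed into the weights, which leaves pure signs
        for \<open>abs_le_of_signed_sums\<close>.\<close>
      let ?w = "\<lambda>I. (\<Prod>i\<in>I. sqrt (?F i q)) * eval2 (H I) p q"
      have "\<bar>?w I\<bar> \<le> C * (1 + q)"
      proof (rule abs_le_of_signed_sums[OF _ _ I(1)])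
        fix \<sigma> :: "nat \<Rightarrow> real"
        assume \<sigma>: "\<And>i. \<sigma> i = 1 \<or> \<sigma> i = - 1"
        let ?r = "\<lambda>i. \<sigma> i * sqrt (?F i q)"
        have r: "?r i ^ 2 = ?F i q" if "i \<in> {1..n}" for i
        proof -
          have "1 \<le> ?F i q"
            using elim(2) that by blast
          then show ?thesis
            using \<sigma>[of i] by (auto simp: power_mult_distrib)
        qed
        have "eval_z n (curve_x p q) (curve_y M p q) ?r P
            = (\<Sum>I\<in>Pow {1..n}. (\<Prod>i\<in>I. ?r i) * eval2 (H I) p q)"
          unfolding H by (rule eval_z_odd_parts) (rule r)
        also have "\<dots> = (\<Sum>I\<in>Pow {1..n}. (\<Prod>i\<in>I. \<sigma> i) * ?w I)"
          by (simp only: prod.distrib mult.assoc)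
        finally have "eval_z n (curve_x p q) (curve_y M p q) ?r P
            = (\<Sum>I\<in>Pow {1..n}. (\<Prod>i\<in>I. \<sigma> i) * ?w I)" .
        then show "\<bar>\<Sum>I\<in>Pow {1..n}. (\<Prod>i\<in>I. \<sigma> i) * ?w I\<bar> \<le> C * (1 + q)"
          using elim(1)[rule_format, of ?r] r by simp
      qed simp
      then have "\<bar>?w I\<bar> ^ 2 \<le> (C * (1 + q)) ^ 2"
        by (intro power_mono) auto
      also have "\<bar>?w I\<bar> ^ 2 = (\<Prod>i\<in>I. ?F i q) * eval2 (H I) p q ^ 2"
      proof -
        have "(\<Prod>i\<in>I. sqrt (?F i q)) ^ 2 = (\<Prod>i\<in>I. ?F i q)"
          unfolding prod_power_distrib
          using elim(2) I(1) by (intro prod.cong real_sqrt_pow2) (auto intro: order_trans[OF zero_le_one])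
        then show ?thesis
          by (simp add: power_mult_distrib)
      qed
      finally have "(\<Prod>i\<in>I. ?F i q) * eval2 (H I) p q ^ 2 \<le> (C * (1 + q)) ^ 2" .
      moreover have "?F i0 q \<le> (\<Prod>i\<in>I. ?F i q)"
      proof -
        have "(\<Prod>i\<in>I. ?F i q) = ?F i0 q * (\<Prod>i\<in>I - {i0}. ?F i q)"
          using I(1) i0(1) finite_subset by (intro prod.remove) auto
        moreover have "1 \<le> (\<Prod>i\<in>I - {i0}. ?F i q)"
          using elim(2) I(1) by (intro prod_ge_1) auto
        moreover have "1 \<le> ?F i0 q"
          using elim(2) i0(2) by blast
        ultimately show ?thesis
          by simp
      qed
      then have "?F i0 q * eval2 (H I) p q ^ 2 \<le> (\<Prod>i\<in>I. ?F i q) * eval2 (H I) p q ^ 2"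
        by (rule mult_right_mono) simp
      ultimately have "?F i0 q * eval2 (H I) p q ^ 2 \<le> (C * (1 + q)) ^ 2"
        by linarith
      moreover have "1 \<le> ?F i0 q"
        using elim(2) i0(2) by blast
      ultimately have "eval2 (H I) p q ^ 2 \<le> (C * (1 + q)) ^ 2 / ?F i0 q"
        by (simp add: le_divide_eq mult.commute)
      also have "\<dots> = C ^ 2 * ((1 + q) ^ 2 / q ^ 2) * inverse (?F i0 q / q ^ 2)"
        using elim(3) by (simp add: power_mult_distrib)
      finally show ?case .
    qed
    have "((\<lambda>q. (1 + q) ^ 2 / q ^ 2) \<longlongrightarrow> 1) (at_top :: real filter)"
      by real_asymp
    then have "((\<lambda>q. C ^ 2 * ((1 + q) ^ 2 / q ^ 2) * inverse (?F i0 q / q ^ 2)) \<longlongrightarrow> C ^ 2 * 1 * 0) at_top"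
      using at_top[OF i0(2)] by (intro tendsto_mult tendsto_const tendsto_inverse_0_at_top)
    then have lim: "((\<lambda>q. C ^ 2 * ((1 + q) ^ 2 / q ^ 2) * inverse (?F i0 q / q ^ 2)) \<longlongrightarrow> 0) at_top"
      by (simp only: mult_zero_right)
    have "((\<lambda>q. eval2 (H I) p q ^ 2) \<longlongrightarrow> 0) at_top"
      by (rule tendsto_sandwich[OF _ bound tendsto_const lim]) simp
    then have "((\<lambda>q. sqrt (eval2 (H I) p q ^ 2)) \<longlongrightarrow> sqrt 0) at_top"
      by (rule tendsto_real_sqrt)
    then have "(poly (map_poly (\<lambda>a. poly a p) (H I)) \<longlongrightarrow> 0) at_top"
      by (simp add: tendsto_rabs_zero_iff eval2_map_poly)
    from poly_eq_0_of_tendsto_0[OF this] show ?thesis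
      by (simp add: eval2_map_poly)
  qed
  have "eval_z n (curve_x p q) (curve_y M p q) r P = eval2 (H {}) p q"
    if r: "\<forall>i\<in>{1..n}. r i ^ 2 = eval2 (f i) (curve_x p q) (curve_y M p q)" for p q r
  proof -
    have "eval_z n (curve_x p q) (curve_y M p q) r P = (\<Sum>I\<in>Pow {1..n}. (\<Prod>i\<in>I. r i) * eval2 (H I) p q)"
      unfolding H by (rule eval_z_odd_parts) (use r in blast)
    also have "\<dots> = (\<Sum>I\<in>{{}}. (\<Prod>i\<in>I. r i) * eval2 (H I) p q)"
      using vanish by (intro sum.mono_neutral_right) auto
    finally show ?thesis
      by simp
  qed
  then show ?thesis
    by (intro exI[of _ "H {}"]) simp
qed


subsection \<open>The Pythagoras number\<close>

theorem theorem2p8: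
  fixes n s :: nat and f :: "nat \<Rightarrow> real poly poly"
  assumes "square_independent n f"
    and "\<And>i. i \<in> {1..n} \<Longrightarrow> \<not> constant_poly2 (f i)"
    and "\<And>i. i \<in> {1..n} \<Longrightarrow> y_lead_coeff (f i) > 0"
    and "s > 1"
  shows "pythagoras_number (2 * s) (sqrt_ext_ring n f) = \<infinity>"
proof -
  have "\<not> pythagoras_bound (sqrt_ext_ring n f) (2 * s) g" for g
  proof
    assume bound: "pythagoras_bound (sqrt_ext_ring n f) (2 * s) g"
    \<comment> \<open>One more than the sum of all x-degrees exceeds each of them; coefficients
      beyond the y-degree are 0 and have degree 0.\<close>
    define M where "M = Suc (\<Sum>i\<in>{1..n}. \<Sum>j\<le>degree (f i). degree (coeff (f i) j))"
    have M: "degree (coeff (f i) j) < M" if "i \<in> {1..n}" for i j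
    proof (cases "j \<le> degree (f i)")
      case True
      then have "degree (coeff (f i) j) \<le> (\<Sum>j\<le>degree (f i). degree (coeff (f i) j))"
        by (intro member_le_sum) auto
      also have "\<dots> \<le> (\<Sum>i\<in>{1..n}. \<Sum>j\<le>degree (f i). degree (coeff (f i) j))"
        using that by (intro member_le_sum[of i "{1..n}" "\<lambda>i. \<Sum>j\<le>degree (f i). degree (coeff (f i) j)"]) auto
      finally show ?thesis
        by (simp add: M_def)
    qed (simp add: M_def coeff_eq_0)
    \<comment> \<open>The length obstruction will give \<open>N < 2 ^ l\<close> with
      \<open>l \<le> g\<close>, which this choice contradicts.\<close>
    define N where "N = (2 :: nat) ^ g"
    have "\<exists>b :: real poly. \<forall>j\<le>N. poly b (real j) = (if k < j then 1 else 0)" for k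
    proof -
      obtain b :: "real poly"
        where "\<forall>x\<in>real ` {..N}. poly b x = (if real k < x then 1 else 0)"
        using interpolation_exists[of "real ` {..N}" "\<lambda>x. if real k < x then 1 else 0"] by auto
      then show ?thesis
        by (intro exI[of _ b]) simp
    qed
    then obtain b :: "nat \<Rightarrow> real poly"
      where b: "\<And>k j. j \<le> N \<Longrightarrow> poly (b k) (real j) = (if k < j then 1 else 0)"
      by metis
    \<comment> \<open>The inverse of the substitution: \<open>v\<close> is y minus the
      \<open>M\<close>-th power of x, and \<open>u\<close> is x minus the cube of \<open>v\<close>.
      They express \<open>q\<close> and \<open>p\<close> through x and y.\<close>
    define v where "v = [:0, 1:] - [:monom (1 :: real) M:]"
    define u where "u = [:[:0, 1:]:] - v ^ 3"
    have v: "eval2 v (curve_x p q) (curve_y M p q) = q" for p q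
      by (simp add: v_def curve_y_def poly_monom)
    have u: "eval2 u (curve_x p q) (curve_y M p q) = p" for p q
      by (simp add: u_def v) (simp add: curve_x_def)
    \<comment> \<open>\<open>b k\<close> is taken as a polynomial constant in the outer variable, so
      any polynomial may be substituted for that variable; 0 is chosen.\<close>
    have "\<exists>c. \<forall>x y. eval2 c x y = poly (b k) (eval2 u x y)" for k
      using eval2_compose[of "[:b k:]" u 0] by simp
    then obtain c where c: "\<And>k x y. eval2 (c k) x y = poly (b k) (eval2 u x y)"
      by metis
    define F where "F = (\<Sum>k<N. (1 + c k * v) ^ (2 * s))"
    have F: "eval2 F (curve_x p q) (curve_y M p q) = (\<Sum>k<N. (1 + poly (b k) p * q) ^ (2 * s))" for p q
      by (simp add: F_def eval2_sum c u v)
    let ?a = "relation_ideal n f +>\<^bsub>poly_ring_z n\<^esub> z_const F"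
    have "?a \<in> carrier (sqrt_ext_ring n f)"
      unfolding carrier_sqrt_ext_ring using z_const_closed by blast
    moreover have "sum_of_powers (sqrt_ext_ring n f) (2 * s) N ?a"
      unfolding F_def by (rule sum_of_powers_coset)
    ultimately obtain l where l: "l \<le> g" "sum_of_powers (sqrt_ext_ring n f) (2 * s) l ?a"
      using bound unfolding pythagoras_bound_def by blast
    from l(2) obtain B where B: "\<And>x y r. (\<And>i. i \<in> {1..n} \<Longrightarrow> r i ^ 2 = eval2 (f i) x y) \<Longrightarrow>
        (\<Sum>j<l. eval_z n x y r (B j) ^ (2 * s)) = eval2 F x y"
      by (rule sum_of_powers_cosetD) blast
    have "\<forall>j\<in>{..<l}. \<exists>H. \<forall>p. \<forall>\<^sub>F q in at_top. \<forall>r.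
        (\<forall>i\<in>{1..n}. r i ^ 2 = eval2 (f i) (curve_x p q) (curve_y M p q)) \<longrightarrow>
        eval_z n (curve_x p q) (curve_y M p q) r (B j) = eval2 H p q"
    \<comment> \<open>The growth hypothesis: at a real point the powers of the representatives sum
      to \<open>F\<close>, whose root is linear in \<open>q\<close>, with a constant depending on
      \<open>p\<close> alone.\<close>
    proof (rule ballI, rule eval_z_polynomial_on_curves)
      fix j p
      assume j: "j \<in> {..<l}"
      obtain C where C: "\<And>q. 0 \<le> q \<Longrightarrow>
          (\<Sum>k<N. (1 + poly (b k) p * q) ^ (2 * s)) \<le> (C * (1 + q)) ^ (2 * s)" "0 \<le> C"
        by (rule linear_powers_bound[where m = s and N = N and c = "\<lambda>k. poly (b k) p"])
          (use assms(4) in auto)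
      have "\<forall>\<^sub>F q in at_top. \<forall>r.
          (\<forall>i\<in>{1..n}. r i ^ 2 = eval2 (f i) (curve_x p q) (curve_y M p q)) \<longrightarrow>
          \<bar>eval_z n (curve_x p q) (curve_y M p q) r (B j)\<bar> \<le> C * (1 + q)"
        using eventually_ge_at_top[of 0]
      proof eventually_elim
        case (elim q)
        show ?case
        proof (intro allI impI)
          fix r
          assume "\<forall>i\<in>{1..n}. r i ^ 2 = eval2 (f i) (curve_x p q) (curve_y M p q)"
          then have "(\<Sum>j<l. eval_z n (curve_x p q) (curve_y M p q) r (B j) ^ (2 * s))
              = eval2 F (curve_x p q) (curve_y M p q)"
            by (intro B) simp
          then have "(\<Sum>j<l. eval_z n (curve_x p q) (curve_y M p q) r (B j) ^ (2 * s))
              \<le> (C * (1 + q)) ^ (2 * s)"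
            using C(1)[OF elim] by (simp add: F)
          then show "\<bar>eval_z n (curve_x p q) (curve_y M p q) r (B j)\<bar> \<le> C * (1 + q)"
            using C(2) elim assms(4) j
            by (intro abs_le_of_sum_even_powers[where A = "{..<l}" and m = s]) auto
        qed
      qed
      then show "\<exists>C. \<forall>\<^sub>F q in at_top. \<forall>r.
          (\<forall>i\<in>{1..n}. r i ^ 2 = eval2 (f i) (curve_x p q) (curve_y M p q)) \<longrightarrow>
          \<bar>eval_z n (curve_x p q) (curve_y M p q) r (B j)\<bar> \<le> C * (1 + q)" ..
    qed (use M assms(2,3) in auto)
    from bchoice[OF this] obtain H where H: "\<And>j p. j < l \<Longrightarrow> \<forall>\<^sub>F q in at_top. \<forall>r.
        (\<forall>i\<in>{1..n}. r i ^ 2 = eval2 (f i) (curve_x p q) (curve_y M p q)) \<longrightarrow>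
        eval_z n (curve_x p q) (curve_y M p q) r (B j) = eval2 (H j) p q"
      by blast
    have "N < 2 ^ l"
    proof (rule sum_of_powers_length_bound[OF assms(4)])
      fix p
      have "\<forall>\<^sub>F q in at_top. \<forall>j\<in>{..<l}. \<forall>r.
          (\<forall>i\<in>{1..n}. r i ^ 2 = eval2 (f i) (curve_x p q) (curve_y M p q)) \<longrightarrow>
          eval_z n (curve_x p q) (curve_y M p q) r (B j) = eval2 (H j) p q"
        using H by (intro eventually_ball_finite) auto
      \<comment> \<open>Nonnegative values make the \<open>sqrt\<close> terms genuine roots, so real
        points exist for large \<open>q\<close>.\<close>
      moreover have "\<forall>\<^sub>F q in at_top. \<forall>i\<in>{1..n}. 0 \<le> eval2 (f i) (curve_x p q) (curve_y M p q)"
      proof (intro eventually_ball_finite ballI)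
        fix i
        assume "i \<in> {1..n}"
        then have "\<forall>\<^sub>F q in at_top. 0 \<le> eval2 (f i) (curve_x p q) (curve_y M p q) / q ^ 2"
          using M assms(2,3) by (intro filterlim_at_top[THEN iffD1, rule_format] eval2_curve_at_top)
        then show "\<forall>\<^sub>F q in at_top. 0 \<le> eval2 (f i) (curve_x p q) (curve_y M p q)"
          using eventually_gt_at_top[of 0] by eventually_elim (simp add: zero_le_divide_iff)
      qed simp
      ultimately show "\<forall>\<^sub>F q in at_top.
          (\<Sum>j<l. eval2 (H j) p q ^ (2 * s)) = (\<Sum>k<N. (1 + poly (b k) p * q) ^ (2 * s))"
      proof eventually_elim
        case (elim q)
        \<comment> \<open>One choice of roots suffices here, because the values of the
          representatives no longer depend on the choice.\<close>
        let ?r = "\<lambda>i. sqrt (eval2 (f i) (curve_x p q) (curve_y M p q))"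
        have r: "?r i ^ 2 = eval2 (f i) (curve_x p q) (curve_y M p q)" if "i \<in> {1..n}" for i
          using elim(2) that by simp
        have "(\<Sum>j<l. eval2 (H j) p q ^ (2 * s))
            = (\<Sum>j<l. eval_z n (curve_x p q) (curve_y M p q) ?r (B j) ^ (2 * s))"
          using elim(1)[rule_format, of _ ?r] r by (intro sum.cong) auto
        also have "\<dots> = eval2 F (curve_x p q) (curve_y M p q)"
          using r by (rule B)
        finally show ?case
          by (simp add: F)
      qed
    qed (use b in auto)
    also have "\<dots> \<le> N"
      unfolding N_def using l(1) by (intro power_increasing) auto
    finally show False
      by simp
  qed
  then show ?thesis
    by (simp add: pythagoras_number_def)
qed

end
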